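(* Consider the asymptotic rare/weak model $ARW(r,\beta)$: $\epsilon=p^{-\beta}$, $\tau=\sqrt{2r\log p}$, $n\sim c(\log p)^{\gamma}$, $p\to\infty$, with $(\beta,r)\in(0,1)^2$. Let $T$ be either the Bonferroni threshold $T_{Bon}$ or, for a fixed $\alpha\in(0,1)$, the ideal FDR threshold $T_{FDR,\alpha}(\epsilon,\tau)$. In each of these cases, the region of successful classification, i.e. the interior of the set of $(\beta,r)\in(0,1)^2$ for which $\widetilde{Err}(T;\epsilon,\tau,p,n)\to0$ as $p\to\infty$, is $$\{(\beta,r):\ 0<\beta<1,\ (1-\sqrt{1-\beta})^2<r<1\}.$$
   Context: $W$ denotes a standard normal random variable, $\Phi$ the standard normal distribution function, $\bar\Phi=1-\Phi$. For $0<\epsilon<1$, $\tau>0$, $t\ge0$ put $TPR(t)=\epsilon\,P\{|\tau+W|>t\}$, $FPR(t)=(1-\epsilon)\,P\{|W|>t\}$, and $\widetilde{FDR}(t)=\frac{FPR(t)}{TPR(t)+FPR(t)}$. The ideal FDR threshold at level $\alpha$ is $T_{FDR,\alpha}(\epsilon,\tau)=\inf\{t>t_0:\widetilde{FDR}(t)<\alpha\}$ with $t_0>0$ a fixed constant. The Bonferroni threshold is $T_{Bon}=\bar\Phi^{-1}(p^{-1})$. With the clipping threshold function $\eta_t(z)=\mathrm{sgn}(z)1_{\{|z|>t\}}$, the proxy separation is $\widetilde{Sep}(t;\epsilon,\tau)=2A/\sqrt B$ with $A=\epsilon\,\tau\,E\{\eta_t(\tau+W)\}$ and $B=\epsilon\,E\{\eta_t^2(\tau+W)\}+(1-\epsilon)\,E\{\eta_t^2(W)\}$,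 and the proxy classification error is $\widetilde{Err}(t;\epsilon,\tau,p,n)=\Phi\left(-\tfrac12\sqrt{p/n}\;\widetilde{Sep}(t;\epsilon,\tau)\right)$. In $ARW(r,\beta)$, $c,\gamma>0$ are fixed constants; $a_p\sim b_p$ means $a_p/b_p\to1$. *)

theory Defs
  imports "HOL-Probability.Probability"
begin

text \<open>The standard normal variable \<open>W\<close> is the identity on the
  probability space \<^term>\<open>std_normal_distribution\<close>.\<close>

definition Phi :: "real \<Rightarrow> real" where
  "Phi = cdf std_normal_distribution"

definition Phi_bar :: "real \<Rightarrow> real" where
  "Phi_bar t = 1 - Phi t"

definition TPR :: "real \<Rightarrow> real \<Rightarrow> real \<Rightarrow> real" where
  "TPR \<epsilon> \<tau> t = \<epsilon> * measure std_normal_distribution {w. \<bar>\<tau> + w\<bar> > t}"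

definition FPR :: "real \<Rightarrow> real \<Rightarrow> real" where
  "FPR \<epsilon> t = (1 - \<epsilon>) * measure std_normal_distribution {w. \<bar>w\<bar> > t}"

definition FDR :: "real \<Rightarrow> real \<Rightarrow> real \<Rightarrow> real" where
  "FDR \<epsilon> \<tau> t = FPR \<epsilon> t / (TPR \<epsilon> \<tau> t + FPR \<epsilon> t)"

definition T_FDR :: "real \<Rightarrow> real \<Rightarrow> real \<Rightarrow> real \<Rightarrow> real" where
  "T_FDR t0 \<alpha> \<epsilon> \<tau> = Inf {t. t > t0 \<and> FDR \<epsilon> \<tau> t < \<alpha>}"

text \<open>\<^const>\<open>Phi_bar\<close> is a bijection from the reals onto the open unit interval, so
  \<open>T_Bon p\<close> is meaningful for \<open>p \<ge> 2\<close>; its values at \<open>p = 0\<close> and \<open>p = 1\<close> are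
  unspecified and irrelevant to limits as \<open>p\<close> tends to infinity.\<close>

definition T_Bon :: "nat \<Rightarrow> real" where
  "T_Bon p = inv Phi_bar (1 / real p)"

definition clip :: "real \<Rightarrow> real \<Rightarrow> real" where
  "clip t z = sgn z * indicat_real {z. \<bar>z\<bar> > t} z"

definition sep_A :: "real \<Rightarrow> real \<Rightarrow> real \<Rightarrow> real" where
  "sep_A t \<epsilon> \<tau> = \<epsilon> * \<tau> * (LINT w|std_normal_distribution. clip t (\<tau> + w))"

definition sep_B :: "real \<Rightarrow> real \<Rightarrow> real \<Rightarrow> real" where
  "sep_B t \<epsilon> \<tau> =
     \<epsilon> * (LINT w|std_normal_distribution. (clip t (\<tau> + w))\<^sup>2)
     + (1 - \<epsilon>) * (LINT w|std_normal_distribution. (clip t w)\<^sup>2)"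

definition Sep :: "real \<Rightarrow> real \<Rightarrow> real \<Rightarrow> real" where
  "Sep t \<epsilon> \<tau> = 2 * sep_A t \<epsilon> \<tau> / sqrt (sep_B t \<epsilon> \<tau>)"

definition Err :: "real \<Rightarrow> real \<Rightarrow> real \<Rightarrow> nat \<Rightarrow> nat \<Rightarrow> real" where
  "Err t \<epsilon> \<tau> p n = Phi (- (1 / 2) * sqrt (real p / real n) * Sep t \<epsilon> \<tau>)"

definition arw_eps :: "real \<Rightarrow> nat \<Rightarrow> real" where
  "arw_eps \<beta> p = real p powr (- \<beta>)"

definition arw_tau :: "real \<Rightarrow> nat \<Rightarrow> real" where
  "arw_tau r p = sqrt (2 * r * ln (real p))"

text \<open>A threshold rule \<open>T\<close> maps \<open>p\<close>, \<open>\<epsilon>\<close>, \<open>\<tau>\<close> to a threshold; \<open>n p\<close> is the sample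
  size used with \<open>p\<close> features.  Points of the phase plane are pairs \<open>(\<beta>, r)\<close>.\<close>

definition success_region ::
    "(nat \<Rightarrow> nat) \<Rightarrow> (nat \<Rightarrow> real \<Rightarrow> real \<Rightarrow> real) \<Rightarrow> (real \<times> real) set" where
  "success_region n T = interior {(\<beta>, r). 0 < \<beta> \<and> \<beta> < 1 \<and> 0 < r \<and> r < 1 \<and>
     (\<lambda>p. Err (T p (arw_eps \<beta> p) (arw_tau r p)) (arw_eps \<beta> p) (arw_tau r p) p (n p))
       \<longlonglongrightarrow> 0}"

end

theory Submission
  imports Defs "HOL-Real_Asymp.Real_Asymp"
begin

text \<open>Write \<open>S = sqrt (2 ln p)\<close>.  Up to subpolynomial factors, \<open>TPR\<close> at thresholds within
  \<open>O(1)\<close> of \<open>S\<close> is \<open>p\<close> to the power \<open>- \<beta> - (1 - sqrt r)\<^sup>2\<close>, while \<open>FPR\<close> at \<open>S\<close> and at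
  the Bonferroni threshold is at most \<open>2 / p\<close>.  The argument of \<open>\<Phi>\<close> in the error is, up to sign, of
  order \<open>sqrt (p / n) * \<tau> * TPR / sqrt (TPR + FPR)\<close>, and \<open>n\<close> and \<open>\<tau>\<close> are polylogarithmic in \<open>p\<close>.

  If \<open>\<beta> + (1 - sqrt r)\<^sup>2 < 1\<close>, both thresholds are at most \<open>S\<close> and have \<open>FPR = O(TPR)\<close>, so
  monotonicity of \<open>TPR\<close> makes the argument diverge.  If \<open>\<beta> + (1 - sqrt r)\<^sup>2 > 1\<close>, both
  thresholds are at least \<open>S - 2\<close>, so \<open>p * TPR\<close> decays polynomially and the error stays away
  from \<open>0\<close>; for the FDR threshold, the point is that \<open>TPR / FPR\<close> is uniformly small on all of
  \<open>t \<le> S\<close>.  The curve \<open>\<beta> + (1 - sqrt r)\<^sup>2 = 1\<close> needs no analysis, since every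
  neighbourhood of a point on it contains points of failure.\<close>

section \<open>Gaussian tails: reflection, shifts and exponential bounds\<close>

lemma emeasure_std_normal:
  assumes "A \<in> sets borel"
  shows "emeasure std_normal_distribution A = (\<integral>\<^sup>+x. ennreal (std_normal_density x) * indicator A x \<partial>lborel)"
  using assms by (subst emeasure_density) auto

interpretation std_normal: real_distribution std_normal_distribution
  by (rule real_dist_normal_dist)

lemma Phi_bar_eq_measure: "Phi_bar x = measure std_normal_distribution {x<..}"
proof -
  have "{x<..} = space std_normal_distribution - {..x}" by auto
  thus ?thesis unfolding Phi_bar_def Phi_def cdf_def
    by (metis std_normal.prob_compl sets_density sets_lborel atMost_borel)
qed

lemma measure_lessThan_std_normal: "measure std_normal_distribution {..<x} = Phi_bar (- x)"
proof -
  have "emeasure std_normal_distribution {..<x} = (\<integral>\<^sup>+y. ennreal (std_normal_density y) * indicator {..<x} y \<partial>lborel)"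
    by (simp add: emeasure_std_normal)
  also have "\<dots> = (\<integral>\<^sup>+y. ennreal (std_normal_density (0 + (-1) * y)) * indicator {..<x} (0 + (-1) * y) \<partial>lborel)"
    by (subst nn_integral_real_affine[where c="-1" and t=0]) auto
  also have "\<dots> = (\<integral>\<^sup>+y. ennreal (std_normal_density y) * indicator {-x<..} y \<partial>lborel)"
    by (intro nn_integral_cong) (auto simp: indicator_def std_normal_density_def)
  also have "\<dots> = emeasure std_normal_distribution {-x<..}"
    by (simp add: emeasure_std_normal)
  finally show ?thesis by (simp add: Phi_bar_eq_measure measure_def)
qed

lemma Phi_bar_nonneg: "0 \<le> Phi_bar x" and Phi_bar_le_1: "Phi_bar x \<le> 1"
  unfolding Phi_bar_eq_measure by auto

lemma Phi_bar_antimono: "x \<le> y \<Longrightarrow> Phi_bar y \<le> Phi_bar x"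
  unfolding Phi_bar_eq_measure by (intro std_normal.finite_measure_mono) auto

text \<open>The ratio of the densities at \<open>d + y\<close> and \<open>y\<close> is
  \<open>exp (- y * d - d\<^sup>2 / 2)\<close>, which for \<open>d \<ge> 0\<close> is bounded by its
  value at the left end \<open>x\<close> of the tail. The sign of \<open>x\<close> is free, so
  \<open>Phi_bar t\<close> can be compared with \<open>Phi_bar (t - \<tau>)\<close> on either side
  of \<open>\<tau>\<close>.\<close>

lemma Phi_bar_shift_le:
  assumes "d \<ge> 0"
  shows "Phi_bar (x + d) \<le> exp (- x * d - d\<^sup>2 / 2) * Phi_bar x"
proof -
  have "emeasure std_normal_distribution {x+d<..} = (\<integral>\<^sup>+y. ennreal (std_normal_density y) * indicator {x+d<..} y \<partial>lborel)"
    by (simp add: emeasure_std_normal)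
  also have "\<dots> = (\<integral>\<^sup>+y. ennreal (std_normal_density (d + 1 * y)) * indicator {x+d<..} (d + 1 * y) \<partial>lborel)"
    by (subst nn_integral_real_affine[where c=1 and t=d]) auto
  also have "\<dots> \<le> (\<integral>\<^sup>+y. ennreal (exp (- x * d - d\<^sup>2 / 2)) * (ennreal (std_normal_density y) * indicator {x<..} y) \<partial>lborel)"
  proof (intro nn_integral_mono)
    fix y :: real
    have "std_normal_density (d + y) \<le> exp (- x * d - d\<^sup>2 / 2) * std_normal_density y" if "x < y"
    proof -
      have "x * d \<le> y * d" using that assms by (intro mult_right_mono) auto
      hence "- (d + y)\<^sup>2 / 2 \<le> (- x * d - d\<^sup>2 / 2) + (- y\<^sup>2 / 2)"
        by (simp add: power2_eq_square field_simps)
      hence "exp (- (d + y)\<^sup>2 / 2) \<le> exp (- x * d - d\<^sup>2 / 2) * exp (- y\<^sup>2 / 2)"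
        by (simp flip: exp_add)
      thus ?thesis unfolding std_normal_density_def by (simp add: field_simps)
    qed
    thus "ennreal (std_normal_density (d + 1 * y)) * indicator {x+d<..} (d + 1 * y)
        \<le> ennreal (exp (- x * d - d\<^sup>2 / 2)) * (ennreal (std_normal_density y) * indicator {x<..} y)"
      by (auto simp: indicator_def simp flip: ennreal_mult)
  qed
  also have "\<dots> = ennreal (exp (- x * d - d\<^sup>2 / 2)) * emeasure std_normal_distribution {x<..}"
    by (simp add: emeasure_std_normal nn_integral_cmult)
  finally show ?thesis
    unfolding Phi_bar_eq_measure by (simp add: std_normal.emeasure_eq_measure flip: ennreal_mult)
qed

lemma Phi_bar_le_exp:
  assumes "x \<ge> 0"
  shows "Phi_bar x \<le> exp (- x\<^sup>2 / 2)"
proof -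
  have "Phi_bar x \<le> exp (- x\<^sup>2 / 2) * Phi_bar 0"
    using Phi_bar_shift_le[OF assms, of 0] by simp
  also have "\<dots> \<le> exp (- x\<^sup>2 / 2)"
    by (intro mult_left_le Phi_bar_le_1) simp
  finally show ?thesis .
qed

lemma Phi_bar_ge_exp:
  assumes "x \<ge> 0"
  shows "Phi_bar x \<ge> exp (- (x + 1)\<^sup>2 / 2 - 1)"
proof -
  txt \<open>The constant \<open>exp (- 1)\<close> in the bound stands for \<open>1 / sqrt (2 * pi)\<close>, and \<open>W\<close> is
    confined to the interval from \<open>x\<close> to \<open>x + 1\<close>.\<close>
  have "2 * pi \<le> 2 * 3.2" using pi_approx by simp
  also have "\<dots> \<le> exp (1::real) ^ 2"
  proof -
    have "(2.7::real)\<^sup>2 \<le> exp 1 ^ 2" using e_approx_32 by (intro power_mono) (auto simp: abs_if split: if_splits)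
    thus ?thesis by (simp add: power2_eq_square)
  qed
  finally have "sqrt (2 * pi) \<le> exp 1" by (rule real_le_lsqrt[rotated]) auto
  hence "exp (- (x + 1)\<^sup>2 / 2 - 1) \<le> std_normal_density (x + 1)"
    unfolding std_normal_density_def exp_diff
    by (simp add: field_simps)
  hence "ennreal (exp (- (x + 1)\<^sup>2 / 2 - 1)) \<le> ennreal (std_normal_density (x + 1)) * emeasure lborel {x<..x+1}"
    by (simp add: ennreal_leI)
  also have "\<dots> = (\<integral>\<^sup>+y. ennreal (std_normal_density (x + 1)) * indicator {x<..x+1} y \<partial>lborel)"
    by (simp add: nn_integral_cmult)
  also have "\<dots> \<le> (\<integral>\<^sup>+y. ennreal (std_normal_density y) * indicator {x<..} y \<partial>lborel)"
  proof (intro nn_integral_mono)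
    fix y :: real
    have "std_normal_density (x + 1) \<le> std_normal_density y" if "x < y" "y \<le> x + 1"
      using that assms unfolding std_normal_density_def
      by (auto simp: field_simps intro!: power_mono)
    thus "ennreal (std_normal_density (x + 1)) * indicator {x<..x+1} y
        \<le> ennreal (std_normal_density y) * indicator {x<..} y"
      by (auto simp: indicator_def intro: ennreal_leI)
  qed
  also have "\<dots> = ennreal (Phi_bar x)"
    by (simp add: emeasure_std_normal Phi_bar_eq_measure flip: std_normal.emeasure_eq_measure)
  finally show ?thesis by (simp add: Phi_bar_nonneg)
qed

lemma Phi_bar_pos: "Phi_bar x > 0"
  using less_le_trans[OF exp_gt_zero Phi_bar_ge_exp[of "max x 0"]] Phi_bar_antimono[of x "max x 0"]
  by simp

section \<open>Continuity, limits and range of the normal distribution function\<close>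

lemma isCont_Phi: "isCont Phi x"
proof -
  have "emeasure std_normal_distribution {x} = 0"
    by (simp add: emeasure_std_normal nn_integral_indicator_singleton)
  thus ?thesis unfolding Phi_def by (simp add: std_normal.isCont_cdf measure_def)
qed

lemma continuous_Phi_bar: "continuous_on A Phi_bar"
  unfolding Phi_bar_def[abs_def]
  by (intro continuous_intros continuous_at_imp_continuous_on ballI isCont_Phi)

lemma Phi_tendsto_0: "(Phi \<longlongrightarrow> 0) at_bot" and Phi_bar_tendsto_0: "(Phi_bar \<longlongrightarrow> 0) at_top"
  and Phi_bar_tendsto_1: "(Phi_bar \<longlongrightarrow> 1) at_bot"
proof -
  show *: "(Phi \<longlongrightarrow> 0) at_bot" unfolding Phi_def by (rule std_normal.cdf_lim_at_bot)
  have **: "(Phi \<longlongrightarrow> 1) at_top" unfolding Phi_def by (rule std_normal.cdf_lim_at_top_prob)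
  show "(Phi_bar \<longlongrightarrow> 0) at_top" "(Phi_bar \<longlongrightarrow> 1) at_bot"
    using tendsto_diff[OF tendsto_const[of 1] **] tendsto_diff[OF tendsto_const[of 1] *]
    unfolding Phi_bar_def[abs_def] by simp_all
qed

text \<open>Reflection turns the tail into the mass strictly below \<open>- x\<close>, to which
  \<open>Phi\<close> adds the endpoint. This serves to show that \<open>Phi (-1)\<close> is
  positive.\<close>

lemma Phi_bar_le_Phi_uminus: "Phi_bar x \<le> Phi (- x)"
proof -
  have "Phi_bar x = measure std_normal_distribution {..<-x}" by (simp add: measure_lessThan_std_normal)
  also have "\<dots> \<le> Phi (-x)" unfolding Phi_def cdf_def by (intro std_normal.finite_measure_mono) auto
  finally show ?thesis .
qed

lemma Phi_bar_surj:
  assumes "0 < y" "y < 1"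
  shows "\<exists>x. Phi_bar x = y"
proof -
  have "eventually (\<lambda>x. Phi_bar x < y) at_top" "eventually (\<lambda>x. Phi_bar x > y) at_bot"
    using order_tendstoD[OF Phi_bar_tendsto_0] order_tendstoD[OF Phi_bar_tendsto_1] assms by auto
  then obtain a b where "Phi_bar a < y" "Phi_bar b > y"
    by (auto simp: eventually_at_top_linorder eventually_at_bot_linorder)
  moreover have "b \<le> a" using calculation Phi_bar_antimono[of a b] by linarith
  ultimately show ?thesis
    using IVT2'[of Phi_bar a y b] continuous_Phi_bar[of "{b..a}"] by auto
qed

text \<open>\<open>inv\<close> is defined by choice, so its defining equation requires
  \<open>1 / p\<close> to be attained; it is, since \<open>1 / p\<close> lies strictly between 0 and
  1.\<close>

lemma Phi_bar_T_Bon: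
  assumes "p \<ge> 2"
  shows "Phi_bar (T_Bon p) = 1 / real p"
proof -
  obtain x where "Phi_bar x = 1 / real p"
    using Phi_bar_surj[of "1 / real p"] assms by auto
  hence "1 / real p \<in> range Phi_bar"
    by (metis rangeI)
  thus ?thesis
    unfolding T_Bon_def by (rule f_inv_into_f)
qed

section \<open>Error rates and separation as combinations of tails\<close>

lemma measure_abs_gt:
  assumes "t \<ge> 0"
  shows "measure std_normal_distribution {w. \<bar>\<tau> + w\<bar> > t} = Phi_bar (t - \<tau>) + Phi_bar (t + \<tau>)"
proof -
  \<comment> \<open>The two half-lines are disjoint because \<open>t \<ge> 0\<close>.\<close>
  have "{w. \<bar>\<tau> + w\<bar> > t} = {t - \<tau><..} \<union> {..<- t - \<tau>}"
    using assms by (auto simp: abs_if split: if_splits)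
  also have "measure std_normal_distribution \<dots> = measure std_normal_distribution {t - \<tau><..}
      + measure std_normal_distribution {..<- t - \<tau>}"
    using assms by (intro std_normal.finite_measure_Union) auto
  finally show ?thesis
    by (simp add: measure_lessThan_std_normal Phi_bar_eq_measure[symmetric] add.commute)
qed

lemma TPR_eq: "t \<ge> 0 \<Longrightarrow> TPR \<epsilon> \<tau> t = \<epsilon> * (Phi_bar (t - \<tau>) + Phi_bar (t + \<tau>))"
  unfolding TPR_def by (simp add: measure_abs_gt)

lemma FPR_eq: "t \<ge> 0 \<Longrightarrow> FPR \<epsilon> t = 2 * (1 - \<epsilon>) * Phi_bar t"
  unfolding FPR_def using measure_abs_gt[of t 0] by simp

text \<open>Where \<open>\<bar>z\<bar> > t \<ge> 0\<close> the sign of \<open>z\<close> is nonzero,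
  so the square of the clip is an indicator.\<close>

lemma sep_B_eq: "t \<ge> 0 \<Longrightarrow> sep_B t \<epsilon> \<tau> = TPR \<epsilon> \<tau> t + FPR \<epsilon> t"
proof -
  assume t: "t \<ge> 0"
  have *: "(LINT w|std_normal_distribution. (clip t (s + w))\<^sup>2)
      = measure std_normal_distribution {w. \<bar>s + w\<bar> > t}" for s
  proof -
    have "(LINT w|std_normal_distribution. (clip t (s + w))\<^sup>2)
        = (LINT w|std_normal_distribution. indicat_real {w. \<bar>s + w\<bar> > t} w)"
      using t by (intro Bochner_Integration.integral_cong) (auto simp: clip_def indicator_def sgn_if)
    thus ?thesis by simp
  qed
  show ?thesis
    unfolding sep_B_def TPR_def FPR_def using *[of \<tau>] *[of 0] by simp
qed

text \<open>The clip is 1 on the upper half-line and -1 on the lower one, so the tails that add up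
  in \<open>TPR\<close> are subtracted here.\<close>

lemma sep_A_eq: "t \<ge> 0 \<Longrightarrow> sep_A t \<epsilon> \<tau> = \<epsilon> * \<tau> * (Phi_bar (t - \<tau>) - Phi_bar (t + \<tau>))"
proof -
  assume t: "t \<ge> 0"
  have "(LINT w|std_normal_distribution. clip t (\<tau> + w))
      = (LINT w|std_normal_distribution. indicat_real {t - \<tau><..} w - indicat_real {..<- t - \<tau>} w)"
    using t by (intro Bochner_Integration.integral_cong) (auto simp: clip_def indicator_def sgn_if abs_if split: if_splits)
  also have "\<dots> = measure std_normal_distribution {t - \<tau><..} - measure std_normal_distribution {..<- t - \<tau>}"
    by (subst Bochner_Integration.integral_diff) (auto simp: std_normal.emeasure_eq_measure)
  finally show ?thesis
    unfolding sep_A_def by (simp add: measure_lessThan_std_normal Phi_bar_eq_measure[symmetric] add.commute)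
qed

lemma TPR_pos: "t \<ge> 0 \<Longrightarrow> \<epsilon> > 0 \<Longrightarrow> TPR \<epsilon> \<tau> t > 0"
  by (simp add: TPR_eq add_pos_pos Phi_bar_pos)

lemma FPR_pos: "t \<ge> 0 \<Longrightarrow> \<epsilon> < 1 \<Longrightarrow> FPR \<epsilon> t > 0"
  by (simp add: FPR_eq Phi_bar_pos)

lemma TPR_antimono: "\<epsilon> \<ge> 0 \<Longrightarrow> 0 \<le> s \<Longrightarrow> s \<le> t \<Longrightarrow> TPR \<epsilon> \<tau> t \<le> TPR \<epsilon> \<tau> s"
  by (auto simp: TPR_eq intro!: mult_left_mono add_mono Phi_bar_antimono)

lemma FPR_antimono: "\<epsilon> \<le> 1 \<Longrightarrow> 0 \<le> s \<Longrightarrow> s \<le> t \<Longrightarrow> FPR \<epsilon> t \<le> FPR \<epsilon> s"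
  by (auto simp: FPR_eq intro!: mult_left_mono Phi_bar_antimono)

lemma Err_eq: "Err t \<epsilon> \<tau> p n = Phi (- (sqrt (real p / real n) * (sep_A t \<epsilon> \<tau> / sqrt (sep_B t \<epsilon> \<tau>))))"
  unfolding Err_def Sep_def by simp

section \<open>The separation ratio compared with the square root of \<open>TPR\<close>\<close>

text \<open>Counting the wrong-sign tail positively gives \<open>sep_A \<le> \<tau> * TPR\<close>,
  and dropping \<open>FPR\<close> gives \<open>sep_B \<ge> TPR\<close>.\<close>

lemma sep_ratio_le:
  assumes "t \<ge> 0" "0 < \<epsilon>" "\<epsilon> < 1" "\<tau> \<ge> 0"
  shows "sep_A t \<epsilon> \<tau> / sqrt (sep_B t \<epsilon> \<tau>) \<le> \<tau> * sqrt (TPR \<epsilon> \<tau> t)"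
proof -
  note pos = TPR_pos[OF assms(1,2), of \<tau>] FPR_pos[OF assms(1,3)]
  have "sep_A t \<epsilon> \<tau> \<le> \<epsilon> * \<tau> * (Phi_bar (t - \<tau>) + Phi_bar (t + \<tau>))"
    unfolding sep_A_eq[OF assms(1)] using assms Phi_bar_nonneg[of "t + \<tau>"] by (intro mult_left_mono) auto
  also have "\<dots> = \<tau> * TPR \<epsilon> \<tau> t"
    by (simp add: TPR_eq assms(1))
  also have "\<dots> = \<tau> * sqrt (TPR \<epsilon> \<tau> t) * sqrt (TPR \<epsilon> \<tau> t)"
    using pos by simp
  also have "\<dots> \<le> \<tau> * sqrt (TPR \<epsilon> \<tau> t) * sqrt (sep_B t \<epsilon> \<tau>)"
    using pos assms by (intro mult_left_mono) (auto simp: sep_B_eq)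
  finally show ?thesis
    using pos assms by (simp add: pos_divide_le_eq sep_B_eq)
qed

text \<open>The wrong-sign tail cancels at most half of the right-sign tail in \<open>sep_A\<close>,
  which keeps \<open>sep_A\<close> comparable to \<open>\<tau> * TPR\<close>.\<close>

lemma Phi_bar_add_le_half:
  assumes "t \<ge> 0" "\<tau> \<ge> 3"
  shows "Phi_bar (t + \<tau>) \<le> Phi_bar (t - \<tau>) / 2"
proof -
  have e: "exp (- 2) \<le> (1 / 2 :: real)"
    using exp_ge_add_one_self[of 2] by (simp add: exp_minus field_simps)
  show ?thesis
  proof (cases "t \<le> \<tau>")
    case True
    have "9 \<le> (t + \<tau>)\<^sup>2"
      using assms power_mono[of 3 "t + \<tau>" 2] by simp
    hence "- (t + \<tau>)\<^sup>2 / 2 \<le> -2 + (- 3 / 2)"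
      by simp
    hence "exp (- (t + \<tau>)\<^sup>2 / 2) \<le> exp (- 2) * exp (- 3 / 2)"
      unfolding exp_add[symmetric] by simp
    \<comment> \<open>\<open>exp (- 3 / 2)\<close> is the value of the lower bound
      \<open>Phi_bar_ge_exp\<close> at 0.\<close>
    also have "\<dots> \<le> 1 / 2 * Phi_bar 0"
      using Phi_bar_ge_exp[of 0] by (intro mult_mono e) auto
    also have "\<dots> \<le> Phi_bar (t - \<tau>) / 2"
      using Phi_bar_antimono[of "t - \<tau>" 0] True by simp
    finally show ?thesis
      using Phi_bar_le_exp[of "t + \<tau>"] assms by simp
  next
    case False
    have "1 * 3 \<le> t * \<tau>"
      using assms False by (intro mult_mono) auto
    \<comment> \<open>The exponent of a shift by \<open>2 * \<tau>\<close> from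
      \<open>t - \<tau>\<close> collapses to \<open>- 2 * t * \<tau>\<close>.\<close>
    hence "- (t - \<tau>) * (2 * \<tau>) - (2 * \<tau>)\<^sup>2 / 2 \<le> -2"
      by (simp add: power2_eq_square algebra_simps)
    hence "exp (- (t - \<tau>) * (2 * \<tau>) - (2 * \<tau>)\<^sup>2 / 2) \<le> exp (-2)"
      by simp
    also note e
    finally have "exp (- (t - \<tau>) * (2 * \<tau>) - (2 * \<tau>)\<^sup>2 / 2) * Phi_bar (t - \<tau>) \<le> 1 / 2 * Phi_bar (t - \<tau>)"
      by (rule mult_right_mono) (rule Phi_bar_nonneg)
    thus ?thesis
      using Phi_bar_shift_le[of "2 * \<tau>" "t - \<tau>"] assms by (simp add: algebra_simps)
  qed
qed

text \<open>The bound on \<open>FPR\<close> gives \<open>sep_B \<le> (1 + K) * TPR\<close>, and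
  \<open>sep_A \<ge> TPR\<close> holds once \<open>\<tau>\<close> makes up for the cancellation
  between the tails.\<close>

lemma sqrt_TPR_le_sep_ratio:
  assumes "t \<ge> 0" "0 < \<epsilon>" "\<epsilon> < 1" "\<tau> \<ge> 3" "FPR \<epsilon> t \<le> K * TPR \<epsilon> \<tau> t" "K \<ge> 0"
  shows "sep_A t \<epsilon> \<tau> / sqrt (sep_B t \<epsilon> \<tau>) \<ge> sqrt (TPR \<epsilon> \<tau> t) / sqrt (1 + K)"
proof -
  note pos = TPR_pos[OF assms(1,2), of \<tau>] FPR_pos[OF assms(1,3)]
  let ?y = "TPR \<epsilon> \<tau> t"
  have "sqrt (sep_B t \<epsilon> \<tau>) \<le> sqrt ((1 + K) * ?y)"
    using assms by (simp add: sep_B_eq algebra_simps)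
  hence "sqrt ?y / sqrt (1 + K) * sqrt (sep_B t \<epsilon> \<tau>) \<le> sqrt ?y / sqrt (1 + K) * sqrt ((1 + K) * ?y)"
    using assms pos by (intro mult_left_mono) auto
  also have "\<dots> = ?y"
    using assms pos by (simp add: real_sqrt_mult)
  \<comment> \<open>If \<open>b \<le> a / 2\<close> then \<open>a - b \<ge> (a + b) / 3\<close>; the
    lost factor 3 is absorbed by \<open>\<tau> \<ge> 3\<close>.\<close>
  also have "\<dots> = 3 * (\<epsilon> * ((Phi_bar (t - \<tau>) + Phi_bar (t + \<tau>)) / 3))"
    using assms by (simp add: TPR_eq)
  also have "\<dots> \<le> \<tau> * (\<epsilon> * (Phi_bar (t - \<tau>) - Phi_bar (t + \<tau>)))"
    using assms Phi_bar_add_le_half[of t \<tau>] Phi_bar_nonneg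
    by (intro mult_mono mult_left_mono mult_nonneg_nonneg divide_nonneg_nonneg add_nonneg_nonneg) auto
  also have "\<dots> = sep_A t \<epsilon> \<tau>"
    using assms by (simp add: sep_A_eq)
  finally show ?thesis
    using pos assms by (simp add: pos_le_divide_eq sep_B_eq)
qed

section \<open>Polynomial rates of \<open>TPR\<close> in the rare/weak model\<close>

lemma filterlim_ln_nat: "filterlim (\<lambda>p. ln (real p)) at_top sequentially"
  by real_asymp

lemma arw_eps_eq: "p > 0 \<Longrightarrow> arw_eps \<beta> p = exp (- \<beta> * ln (real p))"
  unfolding arw_eps_def powr_def by simp

lemma arw_eps_bounds: "p \<ge> 2 \<Longrightarrow> \<beta> > 0 \<Longrightarrow> 0 < arw_eps \<beta> p \<and> arw_eps \<beta> p < 1"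
  unfolding arw_eps_def by (auto intro: powr_less_one)

lemma arw_eps_tendsto_0: "\<beta> > 0 \<Longrightarrow> arw_eps \<beta> \<longlonglongrightarrow> 0"
  unfolding arw_eps_def[abs_def] by real_asymp

lemma arw_tau_eq: "arw_tau r p = sqrt r * sqrt (2 * ln (real p))"
  unfolding arw_tau_def by (simp add: real_sqrt_mult mult_ac)

lemma filterlim_arw_tau: "r > 0 \<Longrightarrow> filterlim (arw_tau r) at_top sequentially"
  unfolding arw_tau_def[abs_def] by real_asymp

lemma TPR_arw_ge:
  assumes "0 < r" "r < 1" "\<beta> + (1 - sqrt r)\<^sup>2 < 1"
  shows "\<exists>\<delta>>0. \<forall>\<^sub>F p in sequentially.
    TPR (arw_eps \<beta> p) (arw_tau r p) (sqrt (2 * ln (real p))) \<ge> real p powr (\<delta> - 1)"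
proof -
  define d where "d = 1 - sqrt r"
  \<comment> \<open>With \<open>S = sqrt (2 * L)\<close> and \<open>L = ln p\<close>, the exponent
    of the lower bound is \<open>- (\<beta> + d\<^sup>2) * L - S * d - 3 / 2\<close>. Half of the
    gap \<open>1 - \<beta> - d\<^sup>2\<close> is kept as \<open>\<delta>\<close>; the other half
    absorbs the terms of order \<open>sqrt L\<close>.\<close>
  define \<delta> where "\<delta> = (1 - \<beta> - d\<^sup>2) / 2"
  have d: "d > 0" using assms by (simp add: d_def)
  have \<delta>: "\<delta> > 0" using assms by (simp add: \<delta>_def d_def)
  have "\<forall>\<^sub>F L in at_top. sqrt (2 * L) * d + 3 / 2 \<le> \<delta> * L"
    using d \<delta> by real_asymp
  hence "\<forall>\<^sub>F p in sequentially. sqrt (2 * ln (real p)) * d + 3 / 2 \<le> \<delta> * ln (real p)"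
    by (rule eventually_compose_filterlim[OF _ filterlim_ln_nat])
  hence "\<forall>\<^sub>F p in sequentially. TPR (arw_eps \<beta> p) (arw_tau r p) (sqrt (2 * ln (real p))) \<ge> real p powr (\<delta> - 1)"
    using eventually_ge_at_top[of 2]
  proof eventually_elim
    case (elim p)
    define L where "L = ln (real p)"
    have L: "L > 0" using elim by (simp add: L_def)
    let ?S = "sqrt (2 * L)"
    have diff: "?S - arw_tau r p = ?S * d"
      by (simp add: arw_tau_eq d_def L_def algebra_simps)
    have "real p powr (\<delta> - 1) = exp ((\<delta> - 1) * L)"
      using elim by (simp add: powr_def L_def)
    also have "(\<delta> - 1) * L \<le> - \<beta> * L + (- (?S * d + 1)\<^sup>2 / 2 - 1)"
    proof -
      have "(?S * d + 1)\<^sup>2 / 2 = L * d\<^sup>2 + ?S * d + 1 / 2"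
        using L by (simp add: power2_sum power_mult_distrib field_simps)
      moreover have "2 * \<delta> * L = L - \<beta> * L - L * d\<^sup>2"
        by (simp add: \<delta>_def field_simps)
      ultimately show ?thesis
        using elim(1) by (simp add: L_def[symmetric] algebra_simps)
    qed
    hence "exp ((\<delta> - 1) * L) \<le> arw_eps \<beta> p * exp (- (?S * d + 1)\<^sup>2 / 2 - 1)"
      using elim by (simp add: arw_eps_eq L_def flip: exp_add)
    also have "\<dots> \<le> arw_eps \<beta> p * Phi_bar (?S - arw_tau r p)"
      unfolding diff using d L by (intro mult_left_mono Phi_bar_ge_exp) (auto simp: arw_eps_def)
    also have "\<dots> \<le> TPR (arw_eps \<beta> p) (arw_tau r p) ?S"
      using L by (auto simp: TPR_eq arw_eps_def Phi_bar_nonneg intro!: mult_left_mono)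
    finally show ?case by (simp add: L_def)
  qed
  with \<delta> show ?thesis by blast
qed

text \<open>The evaluation point lies 2 below \<open>sqrt (2 * ln p)\<close> because the Bonferroni
  threshold is located only up to that distance; monotonicity of \<open>TPR\<close> extends the
  bound to all larger thresholds.\<close>

lemma TPR_arw_le:
  assumes "0 < r" "r < 1" "\<beta> + (1 - sqrt r)\<^sup>2 > 1"
  shows "\<exists>\<delta>>0. \<forall>\<^sub>F p in sequentially. sqrt (2 * ln (real p)) - 2 \<ge> 0 \<and>
    TPR (arw_eps \<beta> p) (arw_tau r p) (sqrt (2 * ln (real p)) - 2) \<le> real p powr (- \<delta> - 1)"
proof -
  define d where "d = 1 - sqrt r"
  \<comment> \<open>Again half of the gap; the other half absorbs
    \<open>2 * sqrt (2 * L) * d - 1\<close>, where the -1 combines -2 from the square with 1 from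
    the factor \<open>exp 1\<close>.\<close>
  define \<delta> where "\<delta> = (\<beta> + d\<^sup>2 - 1) / 2"
  have d: "d > 0" using assms by (simp add: d_def)
  have \<delta>: "\<delta> > 0" using assms by (simp add: \<delta>_def d_def)
  have "\<forall>\<^sub>F L in at_top. 2 * sqrt (2 * L) * d - 1 \<le> \<delta> * L \<and> 2 \<le> sqrt (2 * L) * d \<and> 2 \<le> sqrt (2 * L)"
    using d \<delta> by (intro eventually_conj) real_asymp+
  hence "\<forall>\<^sub>F p in sequentially. 2 * sqrt (2 * ln (real p)) * d - 1 \<le> \<delta> * ln (real p)
      \<and> 2 \<le> sqrt (2 * ln (real p)) * d \<and> 2 \<le> sqrt (2 * ln (real p))"
    by (rule eventually_compose_filterlim[OF _ filterlim_ln_nat])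
  hence "\<forall>\<^sub>F p in sequentially. sqrt (2 * ln (real p)) - 2 \<ge> 0 \<and>
      TPR (arw_eps \<beta> p) (arw_tau r p) (sqrt (2 * ln (real p)) - 2) \<le> real p powr (- \<delta> - 1)"
    using eventually_ge_at_top[of 2]
  proof eventually_elim
    case (elim p)
    define L where "L = ln (real p)"
    have L: "L > 0" using elim by (simp add: L_def)
    let ?S = "sqrt (2 * L)"
    have S: "?S \<ge> 2" "?S * d \<ge> 2" "2 * ?S * d - 1 \<le> \<delta> * L"
      using elim by (auto simp: L_def)
    have diff: "?S - 2 - arw_tau r p = ?S * d - 2"
      by (simp add: arw_tau_eq d_def L_def algebra_simps)
    have tau: "arw_tau r p \<ge> 0"
      using L assms by (simp add: arw_tau_eq L_def)
    have "TPR (arw_eps \<beta> p) (arw_tau r p) (?S - 2)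
        \<le> arw_eps \<beta> p * (Phi_bar (?S - 2 - arw_tau r p) + Phi_bar (?S - 2 - arw_tau r p))"
      using S tau by (auto simp: TPR_eq arw_eps_def intro!: mult_left_mono Phi_bar_antimono)
    also have "\<dots> \<le> arw_eps \<beta> p * (exp 1 * exp (- (?S * d - 2)\<^sup>2 / 2))"
    proof (intro mult_left_mono)
      \<comment> \<open>The factor 2 of the two tails is enlarged to \<open>exp 1\<close> so that it
        merges into the exponent.\<close>
      have "Phi_bar (?S - 2 - arw_tau r p) + Phi_bar (?S - 2 - arw_tau r p) \<le> 2 * exp (- (?S * d - 2)\<^sup>2 / 2)"
        unfolding diff using Phi_bar_le_exp[of "?S * d - 2"] S by simp
      also have "\<dots> \<le> exp 1 * exp (- (?S * d - 2)\<^sup>2 / 2)"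
        using exp_ge_add_one_self[of 1] by (intro mult_right_mono) auto
      finally show "Phi_bar (?S - 2 - arw_tau r p) + Phi_bar (?S - 2 - arw_tau r p)
        \<le> exp 1 * exp (- (?S * d - 2)\<^sup>2 / 2)" .
    qed (auto simp: arw_eps_def)
    also have "\<dots> = exp (- \<beta> * L + (1 + - (?S * d - 2)\<^sup>2 / 2))"
      using elim by (simp only: arw_eps_eq L_def exp_add)
    also have "\<dots> \<le> exp ((- \<delta> - 1) * L)"
    proof -
      have "(?S * d - 2)\<^sup>2 / 2 = L * d\<^sup>2 - 2 * ?S * d + 2"
        using L by (simp add: power2_diff power_mult_distrib field_simps)
      moreover have "2 * \<delta> * L = \<beta> * L + L * d\<^sup>2 - L"
        by (simp add: \<delta>_def field_simps)
      ultimately show ?thesis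
        using S by (simp add: algebra_simps)
    qed
    also have "\<dots> = real p powr (- \<delta> - 1)"
      using elim by (simp add: powr_def L_def)
    finally show ?case using S by (simp add: L_def)
  qed
  with \<delta> show ?thesis by blast
qed

section \<open>Criteria for success and failure of a threshold sequence\<close>

text \<open>From \<open>T p \<le> sqrt (2 * ln p)\<close> and monotonicity, \<open>TPR\<close> at
  \<open>T p\<close> is at least \<open>p powr (\<delta> - 1)\<close>. The argument of
  \<open>Phi\<close> is then at most a negative constant times
  \<open>sqrt (p powr \<delta> / n)\<close>, and \<open>n\<close> grows only like a power of
  \<open>ln p\<close>.\<close>

lemma Err_arw_tendsto_0:
  assumes n: "c > 0" "(\<lambda>p. real (n p)) \<sim>[sequentially] (\<lambda>p. c * ln (real p) powr \<gamma>)"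
    and \<beta>: "0 < \<beta>" and r: "0 < r" "r < 1" and less: "\<beta> + (1 - sqrt r)\<^sup>2 < 1"
    and K: "K \<ge> 0"
    and T: "\<forall>\<^sub>F p in sequentially. 0 \<le> T p \<and> T p \<le> sqrt (2 * ln (real p)) \<and>
              FPR (arw_eps \<beta> p) (T p) \<le> K * TPR (arw_eps \<beta> p) (arw_tau r p) (T p)"
  shows "(\<lambda>p. Err (T p) (arw_eps \<beta> p) (arw_tau r p) p (n p)) \<longlonglongrightarrow> 0"
proof -
  obtain \<delta> where \<delta>: "\<delta> > 0" and TPR: "\<forall>\<^sub>F p in sequentially.
      TPR (arw_eps \<beta> p) (arw_tau r p) (sqrt (2 * ln (real p))) \<ge> real p powr (\<delta> - 1)"
    using TPR_arw_ge[OF r less] by blast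
  define x where "x = (\<lambda>p. sqrt (real p / real (n p)) *
    (sep_A (T p) (arw_eps \<beta> p) (arw_tau r p) / sqrt (sep_B (T p) (arw_eps \<beta> p) (arw_tau r p))))"
  have "filterlim (\<lambda>p. real p powr \<delta> / (c * ln (real p) powr \<gamma>)) at_top sequentially"
    using n(1) \<delta> by real_asymp
  moreover have "(\<lambda>p. real p powr \<delta> / (c * ln (real p) powr \<gamma>)) \<sim>[sequentially] (\<lambda>p. real p powr \<delta> / real (n p))"
    by (intro asymp_equiv_intros asymp_equiv_symI[OF n(2)])
  ultimately have "filterlim (\<lambda>p. real p powr \<delta> / real (n p)) at_top sequentially"
    using asymp_equiv_at_top_transfer by blast
  hence "filterlim (\<lambda>p. sqrt (real p powr \<delta> / real (n p))) at_top sequentially"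
    by (rule filterlim_compose[OF sqrt_at_top])
  hence lim: "filterlim (\<lambda>p. 1 / sqrt (1 + K) * sqrt (real p powr \<delta> / real (n p))) at_top sequentially"
    using K by (intro filterlim_tendsto_pos_mult_at_top[OF tendsto_const]) auto
  have "\<forall>\<^sub>F p in sequentially. arw_tau r p \<ge> 3"
    using filterlim_arw_tau[OF r(1)] by (simp add: filterlim_at_top)
  hence "\<forall>\<^sub>F p in sequentially. 1 / sqrt (1 + K) * sqrt (real p powr \<delta> / real (n p)) \<le> x p"
    using T TPR eventually_ge_at_top[of 2]
  proof eventually_elim
    case (elim p)
    note eps = arw_eps_bounds[OF elim(4) \<beta>]
    have "real p powr \<delta> = real p * real p powr (\<delta> - 1)"
      using elim by (simp add: powr_diff)
    also have "\<dots> \<le> real p * TPR (arw_eps \<beta> p) (arw_tau r p) (T p)"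
      using TPR_antimono[of "arw_eps \<beta> p" "T p" "sqrt (2 * ln (real p))" "arw_tau r p"] elim eps
      by (intro mult_left_mono) auto
    finally have "real p powr \<delta> / real (n p) \<le> real p / real (n p) * TPR (arw_eps \<beta> p) (arw_tau r p) (T p)"
      by (simp add: divide_right_mono)
    hence "sqrt (real p powr \<delta> / real (n p)) \<le> sqrt (real p / real (n p)) * sqrt (TPR (arw_eps \<beta> p) (arw_tau r p) (T p))"
      by (simp flip: real_sqrt_mult)
    hence "1 / sqrt (1 + K) * sqrt (real p powr \<delta> / real (n p))
       \<le> sqrt (real p / real (n p)) * (sqrt (TPR (arw_eps \<beta> p) (arw_tau r p) (T p)) / sqrt (1 + K))"
      using divide_right_mono[of _ _ "sqrt (1 + K)"] K by simp
    also have "\<dots> \<le> x p"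
      unfolding x_def using sqrt_TPR_le_sep_ratio[of "T p" "arw_eps \<beta> p" "arw_tau r p" K] elim eps K
      by (intro mult_left_mono) auto
    finally show ?case .
  qed
  hence "filterlim x at_top sequentially"
    by (rule filterlim_at_top_mono[OF lim])
  hence "filterlim (\<lambda>p. - x p) at_bot sequentially"
    by (simp add: filterlim_uminus_at_bot)
  hence "(\<lambda>p. Phi (- x p)) \<longlonglongrightarrow> 0"
    by (rule filterlim_compose[OF Phi_tendsto_0])
  thus ?thesis unfolding Err_eq x_def .
qed

text \<open>The squared argument of \<open>Phi\<close> is at most
  \<open>p * \<tau>\<^sup>2 * TPR\<close>, a logarithm times a negative power of \<open>p\<close>.
  The argument thus stays above -1 and the error above \<open>Phi (-1) > 0\<close>.\<close>

lemma Err_arw_not_tendsto_0: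
  assumes \<beta>: "0 < \<beta>" and r: "0 < r" "r < 1" and greater: "\<beta> + (1 - sqrt r)\<^sup>2 > 1"
    and T: "\<forall>\<^sub>F p in sequentially. sqrt (2 * ln (real p)) - 2 \<le> T p"
  shows "\<not> (\<lambda>p. Err (T p) (arw_eps \<beta> p) (arw_tau r p) p (n p)) \<longlonglongrightarrow> 0"
proof
  assume lim: "(\<lambda>p. Err (T p) (arw_eps \<beta> p) (arw_tau r p) p (n p)) \<longlonglongrightarrow> 0"
  obtain \<delta> where \<delta>: "\<delta> > 0" and TPR: "\<forall>\<^sub>F p in sequentially. sqrt (2 * ln (real p)) - 2 \<ge> 0 \<and>
      TPR (arw_eps \<beta> p) (arw_tau r p) (sqrt (2 * ln (real p)) - 2) \<le> real p powr (- \<delta> - 1)"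
    using TPR_arw_le[OF r greater] by blast
  have "\<forall>\<^sub>F p in sequentially. 2 * r * ln (real p) * real p powr (- \<delta>) \<le> 1"
    using r(1) \<delta> by real_asymp
  hence "\<forall>\<^sub>F p in sequentially. Phi (-1) \<le> Err (T p) (arw_eps \<beta> p) (arw_tau r p) p (n p)"
    using T TPR eventually_ge_at_top[of 2]
  proof eventually_elim
    case (elim p)
    note eps = arw_eps_bounds[OF elim(4) \<beta>]
    let ?y = "TPR (arw_eps \<beta> p) (arw_tau r p) (T p)"
    have tau: "0 \<le> arw_tau r p" "(arw_tau r p)\<^sup>2 = 2 * r * ln (real p)"
      using elim r by (auto simp: arw_tau_def)
    have "?y \<le> real p powr (- \<delta> - 1)"
      using TPR_antimono[of "arw_eps \<beta> p" "sqrt (2 * ln (real p)) - 2" "T p" "arw_tau r p"] elim eps by auto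
    hence y: "0 \<le> ?y" "real p * ?y \<le> real p powr (- \<delta>)"
      using elim eps TPR_pos[of "T p" "arw_eps \<beta> p" "arw_tau r p"] by (auto simp: powr_diff field_simps)
    \<comment> \<open>For \<open>n p = 0\<close> the quotient is 0 by the convention on
      division.\<close>
    have "real p / real (n p) \<le> real p"
      by (cases "n p = 0") (auto simp: divide_le_eq mult_le_cancel_left1)
    hence "real p / real (n p) * ((arw_tau r p)\<^sup>2 * ?y) \<le> real p * ((arw_tau r p)\<^sup>2 * ?y)"
      using y by (intro mult_right_mono) auto
    also have "\<dots> \<le> 2 * r * ln (real p) * real p powr (- \<delta>)"
      using mult_left_mono[OF y(2), of "2 * r * ln (real p)"] tau zero_le_power2[of "arw_tau r p"]
      by (simp add: mult_ac)
    also have "\<dots> \<le> 1" by (rule elim)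
    finally have "sqrt (real p / real (n p) * ((arw_tau r p)\<^sup>2 * ?y)) \<le> 1"
      by simp
    hence "sqrt (real p / real (n p)) * (arw_tau r p * sqrt ?y) \<le> 1"
      unfolding real_sqrt_mult real_sqrt_abs using tau(1) by simp
    moreover have "sqrt (real p / real (n p)) * (sep_A (T p) (arw_eps \<beta> p) (arw_tau r p) /
        sqrt (sep_B (T p) (arw_eps \<beta> p) (arw_tau r p))) \<le> sqrt (real p / real (n p)) * (arw_tau r p * sqrt ?y)"
      using elim eps tau by (intro mult_left_mono sep_ratio_le) auto
    ultimately show ?case
      unfolding Err_eq Phi_def by (intro std_normal.cdf_nondecreasing) linarith
  qed
  hence "Phi (-1) \<le> 0"
    by (rule tendsto_lowerbound[OF lim]) simp
  thus False
    using Phi_bar_le_Phi_uminus[of 1] Phi_bar_pos[of 1] by simp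
qed

section \<open>The ideal FDR threshold at fixed parameters\<close>

lemma FDR_less_iff:
  assumes "t \<ge> 0" "0 < \<epsilon>" "\<epsilon> < 1"
  shows "FDR \<epsilon> \<tau> t < \<alpha> \<longleftrightarrow> (1 - \<alpha>) * FPR \<epsilon> t < \<alpha> * TPR \<epsilon> \<tau> t"
    and "FDR \<epsilon> \<tau> t \<le> \<alpha> \<longleftrightarrow> (1 - \<alpha>) * FPR \<epsilon> t \<le> \<alpha> * TPR \<epsilon> \<tau> t"
  using TPR_pos[OF assms(1,2), of \<tau>] FPR_pos[OF assms(1,3)]
  by (auto simp: FDR_def pos_divide_less_eq pos_divide_le_eq algebra_simps)

lemma continuous_FDR:
  assumes "0 < \<epsilon>" "\<epsilon> < 1"
  shows "continuous_on {0..} (FDR \<epsilon> \<tau>)"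
proof -
  have "continuous_on {0..} (\<lambda>t. 2 * (1 - \<epsilon>) * Phi_bar t /
      (\<epsilon> * (Phi_bar (t - \<tau>) + Phi_bar (t + \<tau>)) + 2 * (1 - \<epsilon>) * Phi_bar t))"
    using TPR_pos[OF _ assms(1), of _ \<tau>] FPR_pos[OF _ assms(2)]
    by (intro continuous_intros continuous_on_compose2[OF continuous_Phi_bar[of UNIV]])
       (auto simp: TPR_eq FPR_eq less_imp_neq[OF add_pos_pos, symmetric])
  thus ?thesis
    by (rule continuous_on_eq) (simp add: FDR_def TPR_eq FPR_eq)
qed

text \<open>This makes the set under the infimum in \<open>T_FDR\<close> nonempty. By the shift
  bound, \<open>Phi_bar t / Phi_bar (t - \<tau>)\<close> tends to 0 as \<open>t\<close> grows,
  because \<open>\<tau> > 0\<close>.\<close>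

lemma ex_FDR_less:
  assumes "0 < \<epsilon>" "\<epsilon> < 1" "\<tau> > 0" "0 < \<alpha>" "t0 > 0"
  shows "\<exists>t>t0. FDR \<epsilon> \<tau> t < \<alpha>"
proof -
  have "((\<lambda>t. (1 - \<alpha>) * (2 * (1 - \<epsilon>) * exp (- (t - \<tau>) * \<tau> - \<tau>\<^sup>2 / 2))) \<longlongrightarrow> 0) at_top"
    using assms(3) by real_asymp
  hence "\<forall>\<^sub>F t in at_top. (1 - \<alpha>) * (2 * (1 - \<epsilon>) * exp (- (t - \<tau>) * \<tau> - \<tau>\<^sup>2 / 2)) < \<alpha> * \<epsilon>"
    using assms by (intro order_tendstoD) auto
  hence "\<forall>\<^sub>F t in at_top. t > t0 \<and> (1 - \<alpha>) * (2 * (1 - \<epsilon>) * exp (- (t - \<tau>) * \<tau> - \<tau>\<^sup>2 / 2)) < \<alpha> * \<epsilon>"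
    using eventually_gt_at_top[of t0] by eventually_elim auto
  then obtain t where t: "t > t0"
      "(1 - \<alpha>) * (2 * (1 - \<epsilon>) * exp (- (t - \<tau>) * \<tau> - \<tau>\<^sup>2 / 2)) < \<alpha> * \<epsilon>"
    by (auto simp: eventually_at_top_linorder)
  have "(1 - \<alpha>) * FPR \<epsilon> t < \<alpha> * TPR \<epsilon> \<tau> t"
  proof (cases "\<alpha> \<le> 1")
    case True
    have "(1 - \<alpha>) * FPR \<epsilon> t \<le> (1 - \<alpha>) * (2 * (1 - \<epsilon>) * (exp (- (t - \<tau>) * \<tau> - \<tau>\<^sup>2 / 2) * Phi_bar (t - \<tau>)))"
      using Phi_bar_shift_le[of \<tau> "t - \<tau>"] assms t(1) True by (auto simp: FPR_eq intro!: mult_left_mono)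
    also have "\<dots> < \<alpha> * \<epsilon> * Phi_bar (t - \<tau>)"
      using mult_strict_right_mono[OF t(2) Phi_bar_pos[of "t - \<tau>"]] by (simp add: mult_ac)
    also have "\<dots> \<le> \<alpha> * TPR \<epsilon> \<tau> t"
      using assms t(1) Phi_bar_nonneg[of "t + \<tau>"] by (auto simp: TPR_eq intro!: mult_left_mono)
    finally show ?thesis .
  next
    case False
    hence "(1 - \<alpha>) * FPR \<epsilon> t \<le> 0"
      using FPR_pos[of t \<epsilon>] assms t(1) by (intro mult_nonpos_nonneg) auto
    also have "0 < \<alpha> * TPR \<epsilon> \<tau> t"
      using TPR_pos[of t \<epsilon> \<tau>] assms t(1) by simp
    finally show ?thesis .
  qed
  thus ?thesis using t(1) assms FDR_less_iff(1)[of t \<epsilon> \<tau> \<alpha>] by auto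
qed

lemma T_FDR_le: "t > t0 \<Longrightarrow> FDR \<epsilon> \<tau> t < \<alpha> \<Longrightarrow> T_FDR t0 \<alpha> \<epsilon> \<tau> \<le> t"
  unfolding T_FDR_def by (intro cInf_lower bdd_belowI[of _ t0]) auto

lemma T_FDR_ge:
  assumes "0 < \<epsilon>" "\<epsilon> < 1" "\<tau> > 0" "0 < \<alpha>" "t0 > 0"
    and "\<And>t. t > t0 \<Longrightarrow> FDR \<epsilon> \<tau> t < \<alpha> \<Longrightarrow> s \<le> t"
  shows "s \<le> T_FDR t0 \<alpha> \<epsilon> \<tau>"
  unfolding T_FDR_def using ex_FDR_less[OF assms(1-5)] assms(6) by (intro cInf_greatest) auto

text \<open>The infimum lies in the closure of the set, and by continuity of \<open>FDR\<close> the
  strict bound survives there as a weak one.\<close>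

lemma FDR_T_FDR_le:
  assumes "0 < \<epsilon>" "\<epsilon> < 1" "\<tau> > 0" "0 < \<alpha>" "t0 > 0"
  shows "FDR \<epsilon> \<tau> (T_FDR t0 \<alpha> \<epsilon> \<tau>) \<le> \<alpha>"
proof -
  let ?X = "{t. t > t0 \<and> FDR \<epsilon> \<tau> t < \<alpha>}"
  have "Inf ?X \<in> closure ?X"
    using ex_FDR_less[OF assms] by (intro closure_contains_Inf bdd_belowI[of _ t0]) auto
  moreover have "closure ?X \<subseteq> {t \<in> {0..}. FDR \<epsilon> \<tau> t \<le> \<alpha>}"
    using assms
    by (intro closure_minimal continuous_on_closed_Collect_le continuous_FDR continuous_on_const) auto
  ultimately show ?thesis unfolding T_FDR_def by auto
qed

section \<open>Location of both thresholds relative to \<open>sqrt (2 * ln p)\<close>\<close>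

text \<open>Comparing \<open>Phi_bar t = 1 / p\<close> with the two exponential bounds gives
  \<open>t\<^sup>2 \<le> 2 * ln p\<close> and
  \<open>(t + 1)\<^sup>2 \<ge> 2 * ln p - 2\<close>.\<close>

lemma T_Bon_bounds:
  "\<forall>\<^sub>F p in sequentially. 0 \<le> T_Bon p \<and> T_Bon p \<le> sqrt (2 * ln (real p)) \<and> sqrt (2 * ln (real p)) - 2 \<le> T_Bon p"
proof -
  have "(\<lambda>p. 1 / real p) \<longlonglongrightarrow> 0" by real_asymp
  hence "\<forall>\<^sub>F p in sequentially. 1 / real p < Phi_bar 0"
    by (rule order_tendstoD) (rule Phi_bar_pos)
  \<comment> \<open>With \<open>S = sqrt (2 * L)\<close>, the value 3/2 is exactly what
    \<open>(S - 1)\<^sup>2 \<le> 2 * L - 2\<close> requires.\<close>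
  moreover have "\<forall>\<^sub>F p in sequentially. sqrt (2 * ln (real p)) \<ge> 3 / 2" by real_asymp
  ultimately show ?thesis
    using eventually_ge_at_top[of 2]
  proof eventually_elim
    case (elim p)
    define L where "L = ln (real p)"
    define t where "t = T_Bon p"
    have L: "L > 0" using elim by (simp add: L_def)
    have t: "Phi_bar t = exp (- L)"
      using elim by (simp add: t_def Phi_bar_T_Bon L_def exp_minus field_simps)
    have nonneg: "t \<ge> 0"
      using Phi_bar_antimono[of t 0] elim by (fastforce simp: t_def Phi_bar_T_Bon)
    have "exp (- L) \<le> exp (- t\<^sup>2 / 2)"
      using Phi_bar_le_exp[OF nonneg] t by simp
    hence "t \<le> sqrt (2 * L)"
      by (intro real_le_rsqrt) simp
    moreover have "exp (- (t + 1)\<^sup>2 / 2 - 1) \<le> exp (- L)"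
      using Phi_bar_ge_exp[OF nonneg] t by simp
    hence "2 * L - 2 \<le> (t + 1)\<^sup>2"
      by simp
    moreover have "(sqrt (2 * L) - 1)\<^sup>2 \<le> 2 * L - 2"
      using L elim by (simp add: power2_diff L_def)
    ultimately show ?case
      using nonneg power2_le_imp_le[of "sqrt (2 * L) - 1" "t + 1"] by (simp add: t_def L_def)
  qed
qed

lemma FPR_le_two_divide:
  assumes "p \<ge> 2" "0 \<le> \<epsilon>" "\<epsilon> \<le> 1" "t \<ge> 0" "Phi_bar t \<le> 1 / real p"
  shows "FPR \<epsilon> t \<le> 2 / real p"
proof -
  have "2 * (1 - \<epsilon>) * Phi_bar t \<le> 2 * (1 / real p)"
    using assms Phi_bar_nonneg[of t] by (intro mult_mono) auto
  thus ?thesis using assms by (simp add: FPR_eq)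
qed

text \<open>\<open>FPR\<close> is at most \<open>2 / p\<close> while \<open>TPR\<close> is at least
  \<open>p powr (\<delta> - 1)\<close>, so the quotient falls below any \<open>K > 0\<close>. Both
  \<open>sqrt (2 * ln p)\<close> and the Bonferroni threshold meet the conditions on
  \<open>t\<close>.\<close>

lemma FPR_le_TPR_arw:
  assumes \<beta>: "0 < \<beta>" and r: "0 < r" "r < 1" and less: "\<beta> + (1 - sqrt r)\<^sup>2 < 1" and K: "K > 0"
  shows "\<forall>\<^sub>F p in sequentially. \<forall>t\<ge>0. t \<le> sqrt (2 * ln (real p)) \<longrightarrow> Phi_bar t \<le> 1 / real p \<longrightarrow>
    FPR (arw_eps \<beta> p) t \<le> K * TPR (arw_eps \<beta> p) (arw_tau r p) t"
proof -
  obtain \<delta> where \<delta>: "\<delta> > 0" and TPR: "\<forall>\<^sub>F p in sequentially.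
      TPR (arw_eps \<beta> p) (arw_tau r p) (sqrt (2 * ln (real p))) \<ge> real p powr (\<delta> - 1)"
    using TPR_arw_ge[OF r less] by blast
  have "\<forall>\<^sub>F p in sequentially. 2 \<le> K * real p powr \<delta>"
    using \<delta> K by real_asymp
  thus ?thesis
    using TPR eventually_ge_at_top[of 2]
  proof eventually_elim
    case (elim p)
    note eps = arw_eps_bounds[OF elim(3) \<beta>]
    show ?case
    proof (intro allI impI)
      fix t :: real assume t: "0 \<le> t" "t \<le> sqrt (2 * ln (real p))" "Phi_bar t \<le> 1 / real p"
      have "FPR (arw_eps \<beta> p) t \<le> 2 / real p"
        using elim eps t by (intro FPR_le_two_divide) auto
      also have "\<dots> \<le> K * real p powr \<delta> / real p"
        using elim by (intro divide_right_mono) auto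
      also have "\<dots> = K * real p powr (\<delta> - 1)"
        using elim by (simp add: powr_diff)
      also have "\<dots> \<le> K * TPR (arw_eps \<beta> p) (arw_tau r p) t"
        using elim K eps t TPR_antimono[of "arw_eps \<beta> p" t "sqrt (2 * ln (real p))" "arw_tau r p"]
        by (intro mult_left_mono) auto
      finally show "FPR (arw_eps \<beta> p) t \<le> K * TPR (arw_eps \<beta> p) (arw_tau r p) t" .
    qed
  qed
qed

lemma Phi_bar_sqrt_ln_le: "p > 0 \<Longrightarrow> Phi_bar (sqrt (2 * ln (real p))) \<le> 1 / real p"
  using Phi_bar_le_exp[of "sqrt (2 * ln (real p))"] by (simp add: exp_minus inverse_eq_divide)

text \<open>The point \<open>sqrt (2 * ln p)\<close> belongs to the set defining the threshold,
  hence bounds its infimum. The comparison of the rates at the threshold itself restates that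
  \<open>FDR\<close> is at most \<open>\<alpha>\<close> there.\<close>

lemma T_FDR_arw_le:
  assumes \<beta>: "0 < \<beta>" and r: "0 < r" "r < 1" and less: "\<beta> + (1 - sqrt r)\<^sup>2 < 1"
    and \<alpha>: "0 < \<alpha>" "\<alpha> < 1" and t0: "t0 > 0"
  shows "\<forall>\<^sub>F p in sequentially. 0 \<le> T_FDR t0 \<alpha> (arw_eps \<beta> p) (arw_tau r p) \<and>
    T_FDR t0 \<alpha> (arw_eps \<beta> p) (arw_tau r p) \<le> sqrt (2 * ln (real p)) \<and>
    FPR (arw_eps \<beta> p) (T_FDR t0 \<alpha> (arw_eps \<beta> p) (arw_tau r p))
      \<le> \<alpha> / (1 - \<alpha>) * TPR (arw_eps \<beta> p) (arw_tau r p) (T_FDR t0 \<alpha> (arw_eps \<beta> p) (arw_tau r p))"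
proof -
  \<comment> \<open>Halving the odds \<open>\<alpha> / (1 - \<alpha>)\<close> yields a strict
    inequality \<open>FDR < \<alpha>\<close>.\<close>
  have "\<alpha> / (1 - \<alpha>) / 2 > 0" using \<alpha> by simp
  note ev = FPR_le_TPR_arw[OF \<beta> r less this]
  have "\<forall>\<^sub>F p in sequentially. sqrt (2 * ln (real p)) > t0" by real_asymp
  thus ?thesis
    using ev eventually_ge_at_top[of 2]
  proof eventually_elim
    case (elim p)
    note eps = arw_eps_bounds[OF elim(3) \<beta>]
    let ?S = "sqrt (2 * ln (real p))" and ?e = "arw_eps \<beta> p" and ?\<tau> = "arw_tau r p"
    let ?T = "T_FDR t0 \<alpha> ?e ?\<tau>"
    have S: "?S > 0" using elim t0 by simp
    have tau: "?\<tau> > 0" using r S by (simp add: arw_tau_eq)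
    have "(1 - \<alpha>) * FPR ?e ?S \<le> (1 - \<alpha>) * (\<alpha> / (1 - \<alpha>) / 2 * TPR ?e ?\<tau> ?S)"
      using elim S \<alpha> Phi_bar_sqrt_ln_le[of p] by (intro mult_left_mono) auto
    also have "\<dots> = \<alpha> * TPR ?e ?\<tau> ?S / 2"
      using \<alpha> by (simp add: field_simps)
    also have "\<dots> < \<alpha> * TPR ?e ?\<tau> ?S"
      using \<alpha> TPR_pos[of ?S ?e ?\<tau>] S eps by simp
    finally have "?T \<le> ?S"
      using eps S elim FDR_less_iff(1)[of ?S ?e ?\<tau> \<alpha>] by (intro T_FDR_le) auto
    moreover have T: "t0 \<le> ?T"
      using eps tau \<alpha> t0 by (intro T_FDR_ge) auto
    moreover have "(1 - \<alpha>) * FPR ?e ?T \<le> \<alpha> * TPR ?e ?\<tau> ?T"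
      using FDR_T_FDR_le[of ?e ?\<tau> \<alpha> t0] FDR_less_iff(2)[of ?T ?e ?\<tau> \<alpha>] eps tau \<alpha> t0 T by auto
    ultimately show ?case
      using \<alpha> t0 by (auto simp: field_simps)
  qed
qed

lemma T_FDR_arw_ge:
  assumes \<beta>: "0 < \<beta>" and r: "0 < r" "r < 1" and greater: "\<beta> + (1 - sqrt r)\<^sup>2 > 1"
    and \<alpha>: "0 < \<alpha>" "\<alpha> < 1" and t0: "t0 > 0"
  shows "\<forall>\<^sub>F p in sequentially. sqrt (2 * ln (real p)) \<le> T_FDR t0 \<alpha> (arw_eps \<beta> p) (arw_tau r p)"
proof -
  define \<eta> where "\<eta> = \<beta> + (1 - sqrt r)\<^sup>2 - 1"
  have \<eta>: "\<eta> > 0" using greater by (simp add: \<eta>_def)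
  \<comment> \<open>The odds \<open>\<alpha> / (1 - \<alpha>)\<close> come from the FDR condition,
    the factor 2 from bounding both tails in \<open>TPR\<close> by the larger one.\<close>
  define C where "C = 2 * \<alpha> / (1 - \<alpha>)"
  have C: "C > 0" using \<alpha> by (simp add: C_def)
  have "\<forall>\<^sub>F L in at_top. C * exp (- \<eta> * L + sqrt (2 * L) + 3 / 2) \<le> 1"
    using \<eta> C by real_asymp
  hence "\<forall>\<^sub>F p in sequentially. C * exp (- \<eta> * ln (real p) + sqrt (2 * ln (real p)) + 3 / 2) \<le> 1"
    by (rule eventually_compose_filterlim[OF _ filterlim_ln_nat])
  \<comment> \<open>This ensures \<open>FPR \<ge> Phi_bar\<close>, since
    \<open>2 * (1 - e) \<ge> 1\<close>.\<close>
  moreover have "\<forall>\<^sub>F p in sequentially. arw_eps \<beta> p < 1 / 2"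
    by (rule order_tendstoD[OF arw_eps_tendsto_0[OF \<beta>]]) simp
  ultimately show ?thesis
    using eventually_ge_at_top[of 2]
  proof eventually_elim
    case (elim p)
    note eps = arw_eps_bounds[OF elim(3) \<beta>]
    define L where "L = ln (real p)"
    have L: "L > 0" using elim by (simp add: L_def)
    define e \<tau> S where "e = arw_eps \<beta> p" and "\<tau> = arw_tau r p" and "S = sqrt (2 * L)"
    have S: "S > 0" using L by (simp add: S_def)
    have S2: "S\<^sup>2 = 2 * L" using L by (simp add: S_def)
    have \<tau>: "\<tau> = sqrt r * S" by (simp add: \<tau>_def S_def L_def arw_tau_eq)
    have \<tau>_less: "0 < \<tau>" "\<tau> < S" using r S by (auto simp: \<tau>)
    have e: "0 < e" "e < 1 / 2" using elim eps by (auto simp: e_def)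
    have "S \<le> T_FDR t0 \<alpha> e \<tau>"
    proof (rule T_FDR_ge)
      fix t assume t: "t > t0" and fdr: "FDR e \<tau> t < \<alpha>"
      show "S \<le> t"
      proof (rule ccontr)
        assume "\<not> S \<le> t"
        txt \<open>For \<open>t < \<tau>\<close> the bound \<open>TPR \<le> 2 e\<close> is already attained at \<open>\<tau>\<close>, where \<open>FPR\<close> is smaller.\<close>
        define s where "s = max t \<tau>"
        have s: "0 \<le> s" "s \<le> S" "t \<le> s" "\<tau> \<le> s" using \<tau>_less \<open>\<not> S \<le> t\<close> by (auto simp: s_def)
        have "Phi_bar (t - \<tau>) \<le> exp (- (s - \<tau>)\<^sup>2 / 2)"
          using Phi_bar_le_exp[of "t - \<tau>"] Phi_bar_le_1[of "t - \<tau>"] by (auto simp: s_def max_def)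
        moreover have "Phi_bar (t + \<tau>) \<le> Phi_bar (t - \<tau>)"
          using \<tau>_less by (intro Phi_bar_antimono) auto
        ultimately have "TPR e \<tau> t \<le> e * (2 * exp (- (s - \<tau>)\<^sup>2 / 2))"
          using e t t0 by (auto simp: TPR_eq)
        also have "\<dots> = exp (- \<beta> * L) * (2 * exp (- (s - \<tau>)\<^sup>2 / 2))"
          using elim by (simp add: e_def L_def arw_eps_eq)
        finally have "\<alpha> / (1 - \<alpha>) * TPR e \<tau> t \<le> \<alpha> / (1 - \<alpha>) * (exp (- \<beta> * L) * (2 * exp (- (s - \<tau>)\<^sup>2 / 2)))"
          using \<alpha> by (intro mult_left_mono) auto
        also have "\<dots> = C * exp (- \<beta> * L + - (s - \<tau>)\<^sup>2 / 2)"
          unfolding C_def exp_add by simp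
        also have "\<dots> \<le> C * exp ((- \<eta> * L + S + 3 / 2) + (- (s + 1)\<^sup>2 / 2 - 1))"
        proof -
          \<comment> \<open>The squares of \<open>s\<close> cancel in the claimed comparison of
            exponents. What remains is linear and increasing in \<open>s\<close>, so the worst case
            is \<open>s = S\<close>, where the coefficient of \<open>L\<close> becomes
            \<open>- \<eta>\<close>.\<close>
          have "s * (\<tau> + 1) \<le> S * (\<tau> + 1)"
            using s \<tau>_less by (intro mult_right_mono) auto
          also have "S * (\<tau> + 1) = S\<^sup>2 * sqrt r + S"
            by (simp add: \<tau> power2_eq_square algebra_simps)
          finally have 1: "s * \<tau> + s \<le> 2 * sqrt r * L + S"
            by (simp add: S2 algebra_simps)
          have 2: "\<tau>\<^sup>2 = 2 * r * L"
            using r by (simp add: \<tau> power_mult_distrib S2)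
          have 3: "\<eta> * L = \<beta> * L + r * L - 2 * sqrt r * L"
            using r by (simp add: \<eta>_def power2_diff algebra_simps)
          have "- \<beta> * L + - (s - \<tau>)\<^sup>2 / 2 \<le> (- \<eta> * L + S + 3 / 2) + (- (s + 1)\<^sup>2 / 2 - 1)"
            using 1 2 3 by (simp add: power2_diff power2_sum field_simps)
          thus ?thesis using C by simp
        qed
        also have "\<dots> = (C * exp (- \<eta> * L + S + 3 / 2)) * exp (- (s + 1)\<^sup>2 / 2 - 1)"
          by (simp only: exp_add mult.assoc)
        also have "\<dots> \<le> 1 * Phi_bar s"
          using elim Phi_bar_ge_exp[OF s(1)] C by (intro mult_mono) (auto simp: L_def S_def)
        also have "\<dots> \<le> FPR e s"
          using e s mult_right_mono[of 1 "2 * (1 - e)" "Phi_bar s"] Phi_bar_nonneg[of s] by (auto simp: FPR_eq)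
        also have "\<dots> \<le> FPR e t"
          using e s t t0 by (intro FPR_antimono) auto
        finally have "\<alpha> * TPR e \<tau> t \<le> (1 - \<alpha>) * FPR e t"
          using \<alpha> by (simp add: field_simps)
        thus False
          using fdr FDR_less_iff(1)[of t e \<tau> \<alpha>] e t t0 by auto
      qed
    qed (use e \<tau>_less \<alpha> t0 in auto)
    thus ?case by (simp add: e_def \<tau>_def S_def L_def)
  qed
qed

section \<open>Geometry of the phase diagram\<close>

text \<open>With \<open>a = sqrt r\<close> and \<open>b = sqrt (1 - \<beta>)\<close>, each side
  compares \<open>a + b\<close> with 1.\<close>

lemma detection_boundary_iff:
  assumes "0 < \<beta>" "\<beta> < 1" "0 < r" "r < 1"
  shows "\<beta> + (1 - sqrt r)\<^sup>2 < 1 \<longleftrightarrow> (1 - sqrt (1 - \<beta>))\<^sup>2 < r"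
    and "\<beta> + (1 - sqrt r)\<^sup>2 > 1 \<longleftrightarrow> (1 - sqrt (1 - \<beta>))\<^sup>2 > r"
proof -
  define a b where "a = sqrt r" and "b = sqrt (1 - \<beta>)"
  have ab: "0 < a" "a < 1" "0 < b" "b < 1" "r = a\<^sup>2" "\<beta> = 1 - b\<^sup>2"
    using assms by (auto simp: a_def b_def)
  have "\<beta> + (1 - sqrt r)\<^sup>2 < 1 \<longleftrightarrow> (1 - a)\<^sup>2 < b\<^sup>2"
    using ab(6) by (auto simp flip: a_def)
  also have "\<dots> \<longleftrightarrow> 1 - a < b"
    using ab(1-4) by (simp add: power_mono_iff flip: not_le)
  also have "\<dots> \<longleftrightarrow> 1 - b < a" by auto
  also have "\<dots> \<longleftrightarrow> (1 - b)\<^sup>2 < a\<^sup>2"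
    using ab(1-4) by (simp add: power_mono_iff flip: not_le)
  finally show "\<beta> + (1 - sqrt r)\<^sup>2 < 1 \<longleftrightarrow> (1 - sqrt (1 - \<beta>))\<^sup>2 < r"
    by (simp only: ab(5)[symmetric] b_def[symmetric])
  have "\<beta> + (1 - sqrt r)\<^sup>2 > 1 \<longleftrightarrow> (1 - a)\<^sup>2 > b\<^sup>2"
    using ab(6) by (auto simp flip: a_def)
  also have "\<dots> \<longleftrightarrow> 1 - a > b"
    using ab(1-4) by (simp add: power_mono_iff flip: not_le)
  also have "\<dots> \<longleftrightarrow> 1 - b > a" by auto
  also have "\<dots> \<longleftrightarrow> (1 - b)\<^sup>2 > a\<^sup>2"
    using ab(1-4) by (simp add: power_mono_iff flip: not_le)
  finally show "\<beta> + (1 - sqrt r)\<^sup>2 > 1 \<longleftrightarrow> (1 - sqrt (1 - \<beta>))\<^sup>2 > r"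
    by (simp only: ab(5)[symmetric] b_def[symmetric])
qed

text \<open>The claimed region is open and consists of points of success, so it lies in the
  interior. Conversely, an interior point can be lowered slightly in \<open>r\<close> without
  failure, which puts it strictly above the curve.\<close>

lemma success_region_eqI:
  fixes T :: "nat \<Rightarrow> real \<Rightarrow> real \<Rightarrow> real"
  assumes succ: "\<And>\<beta> r. 0 < \<beta> \<Longrightarrow> 0 < r \<Longrightarrow> r < 1 \<Longrightarrow> \<beta> + (1 - sqrt r)\<^sup>2 < 1 \<Longrightarrow>
      (\<lambda>p. Err (T p (arw_eps \<beta> p) (arw_tau r p)) (arw_eps \<beta> p) (arw_tau r p) p (n p)) \<longlonglongrightarrow> 0"
    and fail: "\<And>\<beta> r. 0 < \<beta> \<Longrightarrow> 0 < r \<Longrightarrow> r < 1 \<Longrightarrow> \<beta> + (1 - sqrt r)\<^sup>2 > 1 \<Longrightarrow>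
      \<not> (\<lambda>p. Err (T p (arw_eps \<beta> p) (arw_tau r p)) (arw_eps \<beta> p) (arw_tau r p) p (n p)) \<longlonglongrightarrow> 0"
  shows "success_region n T = {(\<beta>, r). 0 < \<beta> \<and> \<beta> < 1 \<and> (1 - sqrt (1 - \<beta>))\<^sup>2 < r \<and> r < 1}"
    (is "_ = ?U")
proof -
  define X where "X = {(\<beta>, r). 0 < \<beta> \<and> \<beta> < 1 \<and> 0 < r \<and> r < 1 \<and>
     (\<lambda>p. Err (T p (arw_eps \<beta> p) (arw_tau r p)) (arw_eps \<beta> p) (arw_tau r p) p (n p)) \<longlonglongrightarrow> 0}"
  have "?U \<subseteq> X"
  proof
    fix z assume "z \<in> ?U"
    then obtain \<beta> r where z: "z = (\<beta>, r)" "0 < \<beta>" "\<beta> < 1" "(1 - sqrt (1 - \<beta>))\<^sup>2 < r" "r < 1"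
      by auto
    moreover have "r > 0"
      using z(4) by (rule le_less_trans[OF zero_le_power2])
    ultimately show "z \<in> X"
      using succ[of \<beta> r] detection_boundary_iff(1)[of \<beta> r] by (auto simp: X_def)
  qed
  moreover have "open ?U"
    unfolding case_prod_unfold
    by (intro open_Collect_conj open_Collect_less continuous_intros)
  ultimately have "?U \<subseteq> interior X"
    by (rule interior_maximal)
  moreover have "interior X \<subseteq> ?U"
  proof
    fix z assume z: "z \<in> interior X"
    obtain \<beta> r where br: "z = (\<beta>, r)" by force
    have "(\<beta>, r) \<in> X" using z br interior_subset by auto
    hence bounds: "0 < \<beta>" "\<beta> < 1" "0 < r" "r < 1" by (auto simp: X_def)
    obtain e where e: "e > 0" "ball z e \<subseteq> X"
      using z mem_interior by blast
    have "(\<beta>, r - e / 2) \<in> X"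
      using e by (intro subsetD[OF e(2)]) (simp add: br dist_Pair_Pair dist_real_def)
    hence "r - e / 2 > 0" "\<not> \<beta> + (1 - sqrt (r - e / 2))\<^sup>2 > 1"
      using fail[of \<beta> "r - e / 2"] by (auto simp: X_def)
    hence "\<not> (1 - sqrt (1 - \<beta>))\<^sup>2 > r - e / 2"
      using detection_boundary_iff(2)[of \<beta> "r - e / 2"] bounds e by auto
    hence "(1 - sqrt (1 - \<beta>))\<^sup>2 < r" using e by linarith
    thus "z \<in> ?U" using br bounds by simp
  qed
  ultimately show ?thesis
    unfolding success_region_def X_def by blast
qed

theorem theorem6:
  fixes c \<gamma> t0 \<alpha> :: real and n :: "nat \<Rightarrow> nat"
  assumes "c > 0" and "\<gamma> > 0"
    and "(\<lambda>p. real (n p)) \<sim>[sequentially] (\<lambda>p. c * ln (real p) powr \<gamma>)"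
    and "t0 > 0" and "0 < \<alpha>" and "\<alpha> < 1"
  shows "success_region n (\<lambda>p \<epsilon> \<tau>. T_Bon p) =
           {(\<beta>, r). 0 < \<beta> \<and> \<beta> < 1 \<and> (1 - sqrt (1 - \<beta>))\<^sup>2 < r \<and> r < 1}
       \<and> success_region n (\<lambda>p \<epsilon> \<tau>. T_FDR t0 \<alpha> \<epsilon> \<tau>) =
           {(\<beta>, r). 0 < \<beta> \<and> \<beta> < 1 \<and> (1 - sqrt (1 - \<beta>))\<^sup>2 < r \<and> r < 1}"
proof (intro conjI success_region_eqI)
  fix \<beta> r :: real
  assume \<beta>: "0 < \<beta>" and r: "0 < r" "r < 1"
  {
    assume less: "\<beta> + (1 - sqrt r)\<^sup>2 < 1"
    \<comment> \<open>The ratio of \<open>FPR\<close> to \<open>TPR\<close> is bounded by 1 for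
      Bonferroni and by the odds \<open>\<alpha> / (1 - \<alpha>)\<close> for the FDR
      threshold.\<close>
    have "\<forall>\<^sub>F p in sequentially. 0 \<le> T_Bon p \<and> T_Bon p \<le> sqrt (2 * ln (real p)) \<and>
        FPR (arw_eps \<beta> p) (T_Bon p) \<le> 1 * TPR (arw_eps \<beta> p) (arw_tau r p) (T_Bon p)"
      using T_Bon_bounds FPR_le_TPR_arw[OF \<beta> r less zero_less_one] eventually_ge_at_top[of 2]
      by eventually_elim (auto simp: Phi_bar_T_Bon)
    thus "(\<lambda>p. Err (T_Bon p) (arw_eps \<beta> p) (arw_tau r p) p (n p)) \<longlonglongrightarrow> 0"
      by (rule Err_arw_tendsto_0[OF assms(1,3) \<beta> r less zero_le_one])
    have "\<alpha> / (1 - \<alpha>) \<ge> 0" using assms by simp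
    thus "(\<lambda>p. Err (T_FDR t0 \<alpha> (arw_eps \<beta> p) (arw_tau r p)) (arw_eps \<beta> p) (arw_tau r p) p (n p)) \<longlonglongrightarrow> 0"
      by (rule Err_arw_tendsto_0[OF assms(1,3) \<beta> r less _ T_FDR_arw_le[OF \<beta> r less assms(5,6,4)]])
  }
  {
    assume greater: "\<beta> + (1 - sqrt r)\<^sup>2 > 1"
    show "\<not> (\<lambda>p. Err (T_Bon p) (arw_eps \<beta> p) (arw_tau r p) p (n p)) \<longlonglongrightarrow> 0"
      by (rule Err_arw_not_tendsto_0[OF \<beta> r greater]) (use T_Bon_bounds in eventually_elim, auto)
    show "\<not> (\<lambda>p. Err (T_FDR t0 \<alpha> (arw_eps \<beta> p) (arw_tau r p)) (arw_eps \<beta> p) (arw_tau r p) p (n p)) \<longlonglongrightarrow> 0"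
      by (rule Err_arw_not_tendsto_0[OF \<beta> r greater])
         (use T_FDR_arw_ge[OF \<beta> r greater assms(5,6,4)] in eventually_elim, auto)
  }
qed

end
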